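(* For every $\delta>0$ and $\alpha\ge 2$, there exist an SMC instance with ternary valuations in $\{0,1,\alpha\}$ and an optimal stable fractional matching $\mu^*$ for it such that any stable integral matching $\mu^s$ of the instance satisfies $$\mathcal W(\mu^s)\le \left(\alpha-\tfrac12-\delta\right)^{-1}\mathcal W(\mu^* ).$$
   Context: An SMC instance (stable matching problem with cardinal preferences) is a tuple $\langle M,W,U,V\rangle$ with a set $M$ of $n$ men, a set $W$ of $n$ women, and $n\times n$ matrices $U,V$ of non-negative rational numbers; $U(m,w)$ is the value derived by man $m$ from his match with woman $w$ and $V(m,w)$ is the value derived by woman $w$ from her match with man $m$. Ternary valuations in $\{0,1,\alpha\}$ (with $\alpha>1$) means $U,V\in\{0,1,\alpha\}^{n\times n}$. A fractional matching is a map $\mu:M\times W\to\mathbb R_{\ge0}$ with $\sum_{w}\mu(m,w)\le1$ for all $m\in M$ and $\sum_{m}\mu(m,w)\le1$ for all $w\in W$; it is complete if all these hold with equality, and integral if all its values lie in $\{0,1\}$. Unless stated otherwise, matchings (fractional or integral) are assumed complete. Utilities: $u_m(\mu)=\sum_{w} U(m,w)\mu(m,w)$ and $v_w(\mu)=\sum_{m} V(m,w)\mu(m,w)$. The matching $\mu$ is stable if for every $(m,w)\in M\times W$, either $u_m(\mu)\ge U(m,w)$ or $v_w(\mu)\ge V(m,w)$. Social welfare: $\mathcal W(\mu)=\sum_{m} u_m(\mu)+\sum_{w} v_w(\mu)$. An optimal stable fractional matching is one with the highest social welfare among all stable fractional matchings. *)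

theory Defs
  imports Complex_Main
begin

text \<open>
  The men and the women are each indexed by \<open>{..<n}\<close>, and the \<open>n \<times> n\<close> matrices
  (valuations and matchings alike) are functions of type \<open>nat \<Rightarrow> nat \<Rightarrow> real\<close>, with the man as
  first and the woman as second argument. Only the entries with both indices below \<open>n\<close> matter.

  Valuations are real, and rationality is the separate predicate \<open>rational_valuations\<close>, so that
  the matrices may have an irrational \<open>\<alpha>\<close> among their entries.
\<close>

definition smc_instance :: "nat \<Rightarrow> (nat \<Rightarrow> nat \<Rightarrow> real) \<Rightarrow> (nat \<Rightarrow> nat \<Rightarrow> real) \<Rightarrow> bool" where
  "smc_instance n U V \<longleftrightarrow> n > 0 \<and> (\<forall>m<n. \<forall>w<n. U m w \<ge> 0 \<and> V m w \<ge> 0)"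

definition rational_valuations :: "nat \<Rightarrow> (nat \<Rightarrow> nat \<Rightarrow> real) \<Rightarrow> (nat \<Rightarrow> nat \<Rightarrow> real) \<Rightarrow> bool" where
  "rational_valuations n U V \<longleftrightarrow> (\<forall>m<n. \<forall>w<n. U m w \<in> \<rat> \<and> V m w \<in> \<rat>)"

definition ternary_valuations ::
    "real \<Rightarrow> nat \<Rightarrow> (nat \<Rightarrow> nat \<Rightarrow> real) \<Rightarrow> (nat \<Rightarrow> nat \<Rightarrow> real) \<Rightarrow> bool" where
  "ternary_valuations \<alpha> n U V \<longleftrightarrow> (\<forall>m<n. \<forall>w<n. U m w \<in> {0, 1, \<alpha>} \<and> V m w \<in> {0, 1, \<alpha>})"

definition fractional_matching :: "nat \<Rightarrow> (nat \<Rightarrow> nat \<Rightarrow> real) \<Rightarrow> bool" where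
  "fractional_matching n \<mu> \<longleftrightarrow>
     (\<forall>m<n. \<forall>w<n. \<mu> m w \<ge> 0) \<and>
     (\<forall>m<n. (\<Sum>w<n. \<mu> m w) \<le> 1) \<and>
     (\<forall>w<n. (\<Sum>m<n. \<mu> m w) \<le> 1)"

definition complete_matching :: "nat \<Rightarrow> (nat \<Rightarrow> nat \<Rightarrow> real) \<Rightarrow> bool" where
  "complete_matching n \<mu> \<longleftrightarrow>
     fractional_matching n \<mu> \<and>
     (\<forall>m<n. (\<Sum>w<n. \<mu> m w) = 1) \<and>
     (\<forall>w<n. (\<Sum>m<n. \<mu> m w) = 1)"

definition integral_matching :: "nat \<Rightarrow> (nat \<Rightarrow> nat \<Rightarrow> real) \<Rightarrow> bool" where
  "integral_matching n \<mu> \<longleftrightarrow>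
     fractional_matching n \<mu> \<and> (\<forall>m<n. \<forall>w<n. \<mu> m w \<in> {0, 1})"

definition man_utility :: "nat \<Rightarrow> (nat \<Rightarrow> nat \<Rightarrow> real) \<Rightarrow> (nat \<Rightarrow> nat \<Rightarrow> real) \<Rightarrow> nat \<Rightarrow> real" where
  "man_utility n U \<mu> m = (\<Sum>w<n. U m w * \<mu> m w)"

definition woman_utility :: "nat \<Rightarrow> (nat \<Rightarrow> nat \<Rightarrow> real) \<Rightarrow> (nat \<Rightarrow> nat \<Rightarrow> real) \<Rightarrow> nat \<Rightarrow> real" where
  "woman_utility n V \<mu> w = (\<Sum>m<n. V m w * \<mu> m w)"

definition stable ::
    "nat \<Rightarrow> (nat \<Rightarrow> nat \<Rightarrow> real) \<Rightarrow> (nat \<Rightarrow> nat \<Rightarrow> real) \<Rightarrow> (nat \<Rightarrow> nat \<Rightarrow> real) \<Rightarrow> bool" where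
  "stable n U V \<mu> \<longleftrightarrow>
     (\<forall>m<n. \<forall>w<n. man_utility n U \<mu> m \<ge> U m w \<or> woman_utility n V \<mu> w \<ge> V m w)"

definition social_welfare ::
    "nat \<Rightarrow> (nat \<Rightarrow> nat \<Rightarrow> real) \<Rightarrow> (nat \<Rightarrow> nat \<Rightarrow> real) \<Rightarrow> (nat \<Rightarrow> nat \<Rightarrow> real) \<Rightarrow> real" where
  "social_welfare n U V \<mu> = (\<Sum>m<n. man_utility n U \<mu> m) + (\<Sum>w<n. woman_utility n V \<mu> w)"

text \<open>Stable matchings, fractional or integral, are complete by convention.\<close>

definition stable_fractional_matching ::
    "nat \<Rightarrow> (nat \<Rightarrow> nat \<Rightarrow> real) \<Rightarrow> (nat \<Rightarrow> nat \<Rightarrow> real) \<Rightarrow> (nat \<Rightarrow> nat \<Rightarrow> real) \<Rightarrow> bool" where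
  "stable_fractional_matching n U V \<mu> \<longleftrightarrow> complete_matching n \<mu> \<and> stable n U V \<mu>"

definition stable_integral_matching ::
    "nat \<Rightarrow> (nat \<Rightarrow> nat \<Rightarrow> real) \<Rightarrow> (nat \<Rightarrow> nat \<Rightarrow> real) \<Rightarrow> (nat \<Rightarrow> nat \<Rightarrow> real) \<Rightarrow> bool" where
  "stable_integral_matching n U V \<mu> \<longleftrightarrow>
     complete_matching n \<mu> \<and> integral_matching n \<mu> \<and> stable n U V \<mu>"

definition optimal_stable_fractional_matching ::
    "nat \<Rightarrow> (nat \<Rightarrow> nat \<Rightarrow> real) \<Rightarrow> (nat \<Rightarrow> nat \<Rightarrow> real) \<Rightarrow> (nat \<Rightarrow> nat \<Rightarrow> real) \<Rightarrow> bool" where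
  "optimal_stable_fractional_matching n U V \<mu> \<longleftrightarrow>
     stable_fractional_matching n U V \<mu> \<and>
     (\<forall>\<nu>. stable_fractional_matching n U V \<nu> \<longrightarrow> social_welfare n U V \<nu> \<le> social_welfare n U V \<mu>)"

end

theory Submission
  imports Defs "HOL-Analysis.Function_Topology"
begin

text \<open>
  Take units \<open>m\<^sub>i, w\<^sub>i, e\<^sub>i, d\<^sub>i\<close> for \<open>i < K\<close>, where \<open>m\<^sub>i\<close> and \<open>w\<^sub>i\<close> value each other at \<open>1\<close>, while
  \<open>m\<^sub>i\<close> values \<open>w\<^sub>i\<^sub>-\<^sub>1\<close>, \<open>e\<^sub>i\<close> values \<open>w\<^sub>i\<close> and \<open>d\<^sub>i\<close> values \<open>m\<^sub>i\<close> at \<open>\<alpha>\<close>, without reciprocation (in the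
  first unit it is \<open>w\<^sub>0\<close> who values \<open>e\<^sub>0\<close>). In a stable integral matching the blocking pairs
  \<open>(m\<^sub>i, w\<^sub>i)\<close> force \<open>m\<^sub>i\<close> to marry \<open>w\<^sub>i\<close> for all \<open>i > 0\<close>, so a unit is worth \<open>2\<close>.
  Fractionally, a share of \<open>1/\<alpha>\<close> of \<open>w\<^sub>i\<^sub>-\<^sub>1\<close> satisfies \<open>m\<^sub>i\<close>, and the remaining share of
  \<open>1 - 1/\<alpha>\<close> can be spent on the edges to \<open>d\<^sub>i\<close> and \<open>e\<^sub>i\<close>, so a unit is worth
  \<open>1 + 2(\<alpha> - 1) = 2\<alpha> - 1\<close>. In the first unit \<open>w\<^sub>0\<close> is satisfied because \<open>\<alpha>(1 - 1/\<alpha>) \<ge> 1\<close>; this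
  uses \<open>\<alpha> \<ge> 2\<close>. That some optimal stable fractional matching exists is a matter of compactness.
\<close>

section \<open>Existence of optimal stable fractional matchings\<close>

text \<open>Tychonoff, applied once for each of the two arguments.\<close>

lemma compact_unit_functions:
  "compact {\<mu> :: nat \<Rightarrow> nat \<Rightarrow> real. \<forall>m w. \<mu> m w \<in> {0..1}}"
proof -
  have 1: "compact (PiE UNIV (\<lambda>_::nat. {0..1::real}))"
    using compactin_PiE[of "\<lambda>_. euclidean" UNIV "\<lambda>_::nat. {0..1::real}"]
    by (simp add: euclidean_product_topology)
  have "compact (PiE UNIV (\<lambda>_::nat. PiE UNIV (\<lambda>_::nat. {0..1::real})))"
    using compactin_PiE[of "\<lambda>_. euclidean" UNIV "\<lambda>_::nat. PiE UNIV (\<lambda>_::nat. {0..1::real})"] 1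
    by (simp add: euclidean_product_topology)
  moreover have "PiE UNIV (\<lambda>_::nat. PiE UNIV (\<lambda>_::nat. {0..1::real}))
      = {\<mu>. \<forall>m w. \<mu> m w \<in> {0..1}}"
    by (auto simp: PiE_def Pi_def)
  ultimately show ?thesis by simp
qed

lemma continuous_on_entry [continuous_intros]:
  "continuous_on S (\<lambda>\<mu> :: nat \<Rightarrow> nat \<Rightarrow> real. \<mu> m w)"
proof -
  have "continuous_on UNIV (\<lambda>\<mu> :: nat \<Rightarrow> nat \<Rightarrow> real. \<mu> m w)"
    by (rule continuous_on_compose2[OF continuous_on_product_coordinates
          continuous_on_product_coordinates]) auto
  then show ?thesis by (rule continuous_on_subset) auto
qed

lemma continuous_on_utilities [continuous_intros]:
  "continuous_on S (\<lambda>\<mu>. man_utility n U \<mu> m)"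
  "continuous_on S (\<lambda>\<mu>. woman_utility n V \<mu> w)"
  unfolding man_utility_def woman_utility_def by (intro continuous_intros)+

text \<open>For each pair, stability is a union of two closed conditions, since the inequalities are
  weak and utilities depend continuously on the matching.\<close>

lemma closed_stable_fractional:
  "closed {\<mu>. stable_fractional_matching n U V \<mu>}"
  unfolding stable_fractional_matching_def complete_matching_def fractional_matching_def stable_def
  by (intro closed_Collect_conj closed_Collect_all closed_Collect_imp closed_Collect_disj
      open_Collect_const closed_Collect_le closed_Collect_eq continuous_intros)

lemma stable_fractional_matching_cong:
  assumes "\<And>m w. m < n \<Longrightarrow> w < n \<Longrightarrow> \<mu> m w = \<nu> m w"
  shows "stable_fractional_matching n U V \<mu> \<longleftrightarrow> stable_fractional_matching n U V \<nu>"
    and "social_welfare n U V \<mu> = social_welfare n U V \<nu>"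
proof -
  have "(\<Sum>w<n. \<mu> m w) = (\<Sum>w<n. \<nu> m w)" "man_utility n U \<mu> m = man_utility n U \<nu> m"
    if "m < n" for m
    unfolding man_utility_def using that assms by (auto intro!: sum.cong)
  moreover have "(\<Sum>m<n. \<mu> m w) = (\<Sum>m<n. \<nu> m w)" "woman_utility n V \<mu> w = woman_utility n V \<nu> w"
    if "w < n" for w
    unfolding woman_utility_def using that assms by (auto intro!: sum.cong)
  ultimately show "stable_fractional_matching n U V \<mu> \<longleftrightarrow> stable_fractional_matching n U V \<nu>"
    and "social_welfare n U V \<mu> = social_welfare n U V \<nu>"
    unfolding stable_fractional_matching_def complete_matching_def fractional_matching_def
      stable_def social_welfare_def
    using assms by simp_all
qed

lemma optimal_stable_fractional_matching_exists:
  assumes "stable_fractional_matching n U V \<mu>"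
  shows "\<exists>\<mu>. optimal_stable_fractional_matching n U V \<mu>"
proof -
  define S where "S = {\<mu>. \<forall>m w. \<mu> m w \<in> {0..1}} \<inter> {\<mu>. stable_fractional_matching n U V \<mu>}"
  \<comment> \<open>Only the entries below \<open>n\<close> are constrained; zeroing the others moves a matching into the compact set.\<close>
  define t where "t \<nu> = (\<lambda>m w. if m < n \<and> w < n then \<nu> m w else 0)" for \<nu> :: "nat \<Rightarrow> nat \<Rightarrow> real"
  have t: "t \<nu> \<in> S" "social_welfare n U V (t \<nu>) = social_welfare n U V \<nu>"
    if st: "stable_fractional_matching n U V \<nu>" for \<nu>
  proof -
    have "\<nu> m w \<in> {0..1}" if mw: "m < n" "w < n" for m w
    proof -
      have "\<nu> m w \<le> (\<Sum>w<n. \<nu> m w)"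
        using st mw by (intro member_le_sum)
          (auto simp: stable_fractional_matching_def complete_matching_def fractional_matching_def)
      then show ?thesis
        using st mw
        by (auto simp: stable_fractional_matching_def complete_matching_def fractional_matching_def)
    qed
    moreover have "stable_fractional_matching n U V (t \<nu>)"
      using st stable_fractional_matching_cong(1)[of n "t \<nu>" \<nu>] by (simp add: t_def)
    ultimately show "t \<nu> \<in> S" by (auto simp: S_def t_def)
    show "social_welfare n U V (t \<nu>) = social_welfare n U V \<nu>"
      by (rule stable_fractional_matching_cong(2)) (simp add: t_def)
  qed
  have "compact S"
    unfolding S_def by (intro compact_Int_closed compact_unit_functions closed_stable_fractional)
  moreover have "S \<noteq> {}" using t(1)[OF assms] by auto
  moreover have "continuous_on S (social_welfare n U V)"
    unfolding social_welfare_def by (intro continuous_intros)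
  ultimately obtain \<mu> where \<mu>: "\<mu> \<in> S"
    and max: "\<And>\<nu>. \<nu> \<in> S \<Longrightarrow> social_welfare n U V \<nu> \<le> social_welfare n U V \<mu>"
    using continuous_attains_sup[of S "social_welfare n U V"] by auto
  have "social_welfare n U V \<nu> \<le> social_welfare n U V \<mu>"
    if "stable_fractional_matching n U V \<nu>" for \<nu>
    using max[OF t(1)[OF that]] t(2)[OF that] by linarith
  then have "optimal_stable_fractional_matching n U V \<mu>"
    using \<mu> by (simp add: optimal_stable_fractional_matching_def S_def)
  then show ?thesis by (rule exI[of _ \<mu>])
qed

section \<open>Integral matchings\<close>

text \<open>A 0/1 vector of sum one is a standard basis vector, so pairing with it evaluates
  \<open>g\<close> at one index: utilities become the value of a single partner.\<close>

lemma unit_sum_in_01: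
  fixes f :: "nat \<Rightarrow> real"
  assumes "\<And>i. i < n \<Longrightarrow> f i \<in> {0, 1}" "(\<Sum>i<n. f i) = 1"
  obtains i where "i < n" "\<And>j. j < n \<Longrightarrow> f j = (if j = i then 1 else 0)"
    "\<And>g. (\<Sum>j<n. g j * f j) = g i"
proof -
  obtain i where i: "i < n" "f i = 1"
    using assms by (metis insertE lessThan_iff singletonD sum.neutral zero_neq_one)
  have "(\<Sum>j\<in>{..<n} - {i}. f j) = 0"
    using assms(2) i by (simp add: sum_diff1)
  then have "\<forall>j\<in>{..<n} - {i}. f j = 0"
    using assms(1) by (subst (asm) sum_nonneg_eq_0_iff) fastforce+
  then have f: "f j = (if j = i then 1 else 0)" if "j < n" for j
    using that i by auto
  have "(\<Sum>j<n. g j * f j) = g i" for g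
  proof -
    have "(\<Sum>j<n. g j * f j) = (\<Sum>j<n. if j = i then g j else 0)"
      using f by (intro sum.cong) auto
    then show ?thesis using i by simp
  qed
  with that i f show ?thesis by blast
qed

lemma integral_man_partner:
  assumes "complete_matching n \<nu>" "integral_matching n \<nu>" "m < n"
  obtains w where "w < n" "\<And>w'. w' < n \<Longrightarrow> \<nu> m w' = (if w' = w then 1 else 0)"
    "\<And>U. man_utility n U \<nu> m = U m w"
proof (rule unit_sum_in_01[of n "\<nu> m"])
  show "\<nu> m i \<in> {0, 1}" if "i < n" for i
    using assms(2,3) that by (simp add: integral_matching_def)
  show "(\<Sum>i<n. \<nu> m i) = 1"
    using assms(1,3) by (simp add: complete_matching_def)
next
  fix i
  assume "i < n" "\<And>j. j < n \<Longrightarrow> \<nu> m j = (if j = i then 1 else 0)"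
    "\<And>g. (\<Sum>j<n. g j * \<nu> m j) = g i"
  then show thesis by (intro that[of i]) (simp_all only: man_utility_def)
qed

lemma integral_woman_partner:
  assumes "complete_matching n \<nu>" "integral_matching n \<nu>" "w < n"
  obtains m where "m < n" "\<And>m'. m' < n \<Longrightarrow> \<nu> m' w = (if m' = m then 1 else 0)"
    "\<And>V. woman_utility n V \<nu> w = V m w"
proof (rule unit_sum_in_01[of n "\<lambda>m. \<nu> m w"])
  show "\<nu> i w \<in> {0, 1}" if "i < n" for i
    using assms(2,3) that by (simp add: integral_matching_def)
  show "(\<Sum>i<n. \<nu> i w) = 1"
    using assms(1,3) by (simp add: complete_matching_def)
next
  fix i
  assume "i < n" "\<And>j. j < n \<Longrightarrow> \<nu> j w = (if j = i then 1 else 0)"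
    "\<And>g. (\<Sum>j<n. g j * \<nu> j w) = g i"
  then show thesis by (intro that[of i]) (simp_all only: woman_utility_def)
qed

section \<open>The chain instance\<close>

text \<open>
  With \<open>i\<close> ranging over \<open>{..<K}\<close>, the index \<open>i\<close> stands for the main man \<open>m\<^sub>i\<close> or the main woman
  \<open>w\<^sub>i\<close>, and \<open>K + i\<close> for the dummy man \<open>e\<^sub>i\<close> or the dummy woman \<open>d\<^sub>i\<close>.
\<close>

definition chain_U :: "nat \<Rightarrow> real \<Rightarrow> nat \<Rightarrow> nat \<Rightarrow> real" where
  "chain_U K \<alpha> m w =
     (if m = w \<and> w < K then 1
      else if m = Suc w \<and> m < K \<or> m = K + w \<and> 0 < w \<and> w < K then \<alpha> else 0)"

definition chain_V :: "nat \<Rightarrow> real \<Rightarrow> nat \<Rightarrow> nat \<Rightarrow> real" where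
  "chain_V K \<alpha> m w =
     (if m = w \<and> w < K then 1
      else if w = K + m \<and> m < K \<or> m = K \<and> w = 0 then \<alpha> else 0)"

text \<open>The edge from \<open>m\<^sub>0\<close> to the last main woman only serves to make the matching complete.\<close>

definition chain_matching :: "nat \<Rightarrow> real \<Rightarrow> nat \<Rightarrow> nat \<Rightarrow> real" where
  "chain_matching K p m w =
     (if m < K \<and> w < K then (if m = (if Suc w = K then 0 else Suc w) then p else 0)
      else if m < K then (if w = K + m then 1 - p else 0)
      else if w < K then (if m = K + w then 1 - p else 0)
      else (if m = w then p else 0))"

section \<open>Sums over main and dummy agents\<close>

lemma sum_two_blocks:
  fixes f :: "nat \<Rightarrow> 'a::comm_monoid_add"
  shows "(\<Sum>i<2 * K. f i) = (\<Sum>i<K. f i) + (\<Sum>i<K. f (K + i))"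
proof -
  have "(\<Sum>i<2 * K. f i) = (\<Sum>i<K. f i) + (\<Sum>i=K..<K + K. f i)"
    by (simp add: lessThan_atLeast0 sum.atLeastLessThan_concat mult_2)
  then show ?thesis
    using sum.shift_bounds_nat_ivl[of f 0 K K] by (simp add: lessThan_atLeast0 add.commute)
qed

lemma sum_two_blocks_Suc:
  fixes f :: "nat \<Rightarrow> 'a::comm_monoid_add"
  assumes "K = Suc N"
  shows "(\<Sum>i<2 * K. f i) = f 0 + f K + (\<Sum>i<N. f (Suc i) + f (K + Suc i))"
  unfolding sum_two_blocks assms sum.lessThan_Suc_shift by (simp add: sum.distrib ac_simps)

text \<open>Indices \<open>0\<close> and \<open>K\<close> belong to the first unit, which behaves
  differently and gets its own bounds; the other \<open>N\<close> units are treated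
  uniformly.\<close>

lemma sum_two_blocks_le:
  fixes f :: "nat \<Rightarrow> real"
  assumes "K = Suc N" "f 0 \<le> a" "f K \<le> b"
    and "\<And>i. 0 < i \<Longrightarrow> i < K \<Longrightarrow> f i \<le> c" "\<And>i. 0 < i \<Longrightarrow> i < K \<Longrightarrow> f (K + i) \<le> d"
  shows "(\<Sum>i<2 * K. f i) \<le> a + b + real N * (c + d)"
proof -
  have "(\<Sum>i<N. f (Suc i) + f (K + Suc i)) \<le> (\<Sum>i<N. c + d)"
    using assms(1) by (intro sum_mono add_mono assms(4,5)) auto
  with assms(2,3) show ?thesis
    unfolding sum_two_blocks_Suc[OF assms(1)] by simp
qed

lemma sum_two_blocks_ge:
  fixes f :: "nat \<Rightarrow> real"
  assumes "K = Suc N" "a \<le> f 0" "b \<le> f K"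
    and "\<And>i. 0 < i \<Longrightarrow> i < K \<Longrightarrow> c \<le> f i" "\<And>i. 0 < i \<Longrightarrow> i < K \<Longrightarrow> d \<le> f (K + i)"
  shows "a + b + real N * (c + d) \<le> (\<Sum>i<2 * K. f i)"
  using sum_two_blocks_le[of K N "\<lambda>i. - f i" "- a" "- b" "- c" "- d"] assms
  by (simp add: sum_negf algebra_simps)

text \<open>Main agents give weight \<open>p\<close> to a cyclic shift and \<open>1 - p\<close> to
  their dummy; the two dummies of a unit give the missing \<open>p\<close> to each other.\<close>

lemma chain_matching_complete:
  assumes "0 < K" "0 \<le> p" "p \<le> 1"
  shows "complete_matching (2 * K) (chain_matching K p)"
proof -
  have row: "(\<Sum>w<2 * K. chain_matching K p m w) = 1" if "m < 2 * K" for m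
  proof (cases "m < K")
    case True
    have "(\<Sum>w<K. chain_matching K p m w) = (\<Sum>w<K. if w = (if m = 0 then K - 1 else m - 1) then p else 0)"
      using True by (intro sum.cong) (auto simp: chain_matching_def)
    moreover have "(\<Sum>w<K. chain_matching K p m (K + w)) = (\<Sum>w<K. if w = m then 1 - p else 0)"
      using True by (intro sum.cong) (auto simp: chain_matching_def)
    moreover have "(if m = 0 then K - 1 else m - 1) < K" using True by auto
    ultimately show ?thesis using True by (simp add: sum_two_blocks)
  next
    case False
    have "(\<Sum>w<K. chain_matching K p m w) = (\<Sum>w<K. if w = m - K then 1 - p else 0)"
      using False that by (intro sum.cong) (auto simp: chain_matching_def)
    moreover have "(\<Sum>w<K. chain_matching K p m (K + w)) = (\<Sum>w<K. if w = m - K then p else 0)"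
      using False that by (intro sum.cong) (auto simp: chain_matching_def)
    moreover have "m - K < K" using that assms(1) by linarith
    ultimately show ?thesis by (simp add: sum_two_blocks)
  qed
  have col: "(\<Sum>m<2 * K. chain_matching K p m w) = 1" if "w < 2 * K" for w
  proof (cases "w < K")
    case True
    have "(\<Sum>m<K. chain_matching K p m w) = (\<Sum>m<K. if m = (if Suc w = K then 0 else Suc w) then p else 0)"
      using True by (intro sum.cong) (auto simp: chain_matching_def)
    moreover have "(\<Sum>m<K. chain_matching K p (K + m) w) = (\<Sum>m<K. if m = w then 1 - p else 0)"
      using True by (intro sum.cong) (auto simp: chain_matching_def)
    moreover have "(if Suc w = K then 0 else Suc w) < K" using True by auto
    ultimately show ?thesis using True by (simp add: sum_two_blocks)
  next
    case False
    have "(\<Sum>m<K. chain_matching K p m w) = (\<Sum>m<K. if m = w - K then 1 - p else 0)"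
      using False that by (intro sum.cong) (auto simp: chain_matching_def)
    moreover have "(\<Sum>m<K. chain_matching K p (K + m) w) = (\<Sum>m<K. if m = w - K then p else 0)"
      using False that by (intro sum.cong) (auto simp: chain_matching_def)
    moreover have "w - K < K" using that assms(1) by linarith
    ultimately show ?thesis by (simp add: sum_two_blocks)
  qed
  have "chain_matching K p m w \<ge> 0" for m w
    using assms by (simp add: chain_matching_def)
  with row col show ?thesis
    by (simp add: complete_matching_def fractional_matching_def)
qed

lemma chain_U_nonneg: "0 \<le> \<alpha> \<Longrightarrow> 0 \<le> chain_U K \<alpha> m w"
  and chain_V_nonneg: "0 \<le> \<alpha> \<Longrightarrow> 0 \<le> chain_V K \<alpha> m w"
  by (simp_all add: chain_U_def chain_V_def)

section \<open>Stability and welfare of the fractional matching\<close>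

context
  fixes K :: nat and \<alpha> :: real
  assumes K: "0 < K" and alpha: "2 \<le> \<alpha>"
begin

private abbreviation "U \<equiv> chain_U K \<alpha>"
private abbreviation "V \<equiv> chain_V K \<alpha>"
private abbreviation "\<mu> \<equiv> chain_matching K (1 / \<alpha>)"

private lemma mu_nonneg: "0 \<le> \<mu> m w"
  using alpha by (simp add: chain_matching_def)

text \<open>All terms are nonnegative, so a single edge bounds the utility from below; each estimate
  that follows uses one edge of value \<alpha>.\<close>

private lemma man_utility_ge: "w < 2 * K \<Longrightarrow> U m w * \<mu> m w \<le> man_utility (2 * K) U \<mu> m"
  unfolding man_utility_def
  by (rule member_le_sum[where f = "\<lambda>w. U m w * \<mu> m w"])
    (use alpha in \<open>auto intro!: mult_nonneg_nonneg chain_U_nonneg mu_nonneg\<close>)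

private lemma woman_utility_ge: "m < 2 * K \<Longrightarrow> V m w * \<mu> m w \<le> woman_utility (2 * K) V \<mu> w"
  unfolding woman_utility_def
  by (rule member_le_sum[where f = "\<lambda>m. V m w * \<mu> m w"])
    (use alpha in \<open>auto intro!: mult_nonneg_nonneg chain_V_nonneg mu_nonneg\<close>)

private lemma utility_nonneg:
  "0 \<le> man_utility (2 * K) U \<mu> m" "0 \<le> woman_utility (2 * K) V \<mu> w"
  unfolding man_utility_def woman_utility_def using alpha
  by (auto intro!: sum_nonneg mult_nonneg_nonneg chain_U_nonneg chain_V_nonneg mu_nonneg)

private lemma main_man_utility: "1 \<le> man_utility (2 * K) U \<mu> m" if "0 < m" "m < K"
proof -
  obtain i where m: "m = Suc i" using \<open>0 < m\<close> gr0_implies_Suc by blast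
  then have "U m i = \<alpha>" "\<mu> m i = 1 / \<alpha>" "i < 2 * K"
    using that by (simp_all add: chain_U_def chain_matching_def)
  then show ?thesis using man_utility_ge[of i m] alpha by simp
qed

private lemma dummy_man_utility: "\<alpha> - 1 \<le> man_utility (2 * K) U \<mu> (K + i)" if "0 < i" "i < K"
  using man_utility_ge[of i "K + i"] that alpha
  by (auto simp: chain_U_def chain_matching_def right_diff_distrib)

private lemma first_woman_utility: "\<alpha> - 1 \<le> woman_utility (2 * K) V \<mu> 0"
  using woman_utility_ge[of K 0] K alpha
  by (auto simp: chain_V_def chain_matching_def right_diff_distrib)

private lemma dummy_woman_utility: "\<alpha> - 1 \<le> woman_utility (2 * K) V \<mu> (K + i)" if "i < K"
  using woman_utility_ge[of i "K + i"] that alpha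
  by (auto simp: chain_V_def chain_matching_def right_diff_distrib)

text \<open>Only the pairs \<open>(m\<^sub>i, w\<^sub>i)\<close> are valued by both sides, so only
  they could block. For \<open>i > 0\<close> the man already has utility at least \<open>1\<close>;
  for \<open>i = 0\<close> the woman has at least \<open>\<alpha> - 1 \<ge> 1\<close>.\<close>

lemma chain_matching_stable: "stable_fractional_matching (2 * K) U V \<mu>"
proof -
  have "man_utility (2 * K) U \<mu> m \<ge> U m w \<or> woman_utility (2 * K) V \<mu> w \<ge> V m w" for m w
  proof (cases "m = w \<and> w < K")
    case True
    then show ?thesis
      using main_man_utility[of m] first_woman_utility alpha
      by (cases "m = 0") (auto simp: chain_U_def chain_V_def)
  next
    case False
    then have "U m w = 0 \<or> V m w = 0" by (auto simp: chain_U_def chain_V_def)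
    then show ?thesis using utility_nonneg by metis
  qed
  then show ?thesis
    using chain_matching_complete[OF K] alpha
    by (simp add: stable_fractional_matching_def stable_def)
qed

text \<open>After the first unit, \<open>m\<^sub>i\<close> contributes at least \<open>1\<close>,
  and \<open>e\<^sub>i\<close> and \<open>d\<^sub>i\<close> at least \<open>\<alpha> - 1\<close>
  each; all other utilities are estimated by \<open>0\<close>.\<close>

lemma chain_matching_welfare:
  "real (K - 1) * (2 * \<alpha> - 1) \<le> social_welfare (2 * K) U V \<mu>"
proof -
  obtain N where N: "K = Suc N" using K gr0_conv_Suc by auto
  have "0 + 0 + real N * (1 + (\<alpha> - 1)) \<le> (\<Sum>m<2 * K. man_utility (2 * K) U \<mu> m)"
    by (intro sum_two_blocks_ge N utility_nonneg main_man_utility dummy_man_utility)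
  moreover have "0 + 0 + real N * (0 + (\<alpha> - 1)) \<le> (\<Sum>w<2 * K. woman_utility (2 * K) V \<mu> w)"
    by (intro sum_two_blocks_ge N utility_nonneg dummy_woman_utility)
  ultimately show ?thesis
    unfolding social_welfare_def using N by (simp add: algebra_simps)
qed

section \<open>Stable integral matchings of the chain\<close>

text \<open>
  The pair \<open>(m\<^sub>0, w\<^sub>0)\<close> keeps \<open>w\<^sub>0\<close> from being matched to \<open>m\<^sub>1\<close>, who then has to be content with
  \<open>w\<^sub>1\<close>, which in turn makes \<open>w\<^sub>1\<close> unavailable to \<open>m\<^sub>2\<close>, and so on along the chain.
\<close>

lemma chain_integral_forced:
  assumes st: "stable_integral_matching (2 * K) U V \<nu>" and i: "0 < i" "i < K"
  shows "\<nu> i i = 1"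
proof -
  have cm: "complete_matching (2 * K) \<nu>" "integral_matching (2 * K) \<nu>"
    and stab: "\<And>m w. m < 2 * K \<Longrightarrow> w < 2 * K \<Longrightarrow>
      man_utility (2 * K) U \<nu> m \<ge> U m w \<or> woman_utility (2 * K) V \<nu> w \<ge> V m w"
    using st by (auto simp: stable_integral_matching_def stable_def)
  \<comment> \<open>This is the non-blocking of \<open>(m\<^sub>j, w\<^sub>j)\<close> in terms of
    their partners; uniqueness of the partner of \<open>w\<^sub>j\<close> serves to exclude
    \<open>m\<^sub>j\<^sub>+\<^sub>1\<close>.\<close>
  have cases: "\<exists>m w. m < 2 * K \<and> w < 2 * K \<and> \<nu> j w = 1 \<and> \<nu> m j = 1 \<and>
      (\<forall>m'<2 * K. \<nu> m' j = 1 \<longrightarrow> m' = m) \<and> (U j w \<ge> 1 \<or> V m j \<ge> 1)" if "j < K" for j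
  proof -
    from that have j: "j < 2 * K" by simp
    obtain w where w: "w < 2 * K" "\<And>w'. w' < 2 * K \<Longrightarrow> \<nu> j w' = (if w' = w then 1 else 0)"
      "\<And>U. man_utility (2 * K) U \<nu> j = U j w"
      using integral_man_partner[OF cm j] by blast
    obtain m where m: "m < 2 * K" "\<And>m'. m' < 2 * K \<Longrightarrow> \<nu> m' j = (if m' = m then 1 else 0)"
      "\<And>V. woman_utility (2 * K) V \<nu> j = V m j"
      using integral_woman_partner[OF cm j] by blast
    have "U j j = 1" "V j j = 1" using that by (simp_all add: chain_U_def chain_V_def)
    then have "U j w \<ge> 1 \<or> V m j \<ge> 1" using stab[OF j j] w(3) m(3) by simp
    moreover have "\<forall>m'<2 * K. \<nu> m' j = 1 \<longrightarrow> m' = m" using m(2) by simp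
    moreover have "\<nu> j w = 1" "\<nu> m j = 1" using w(2)[OF w(1)] m(2)[OF m(1)] by simp_all
    ultimately show ?thesis using w(1) m(1) by blast
  qed
  \<comment> \<open>The claim starts at index \<open>1\<close> because \<open>w\<^sub>0\<close> may
    marry \<open>e\<^sub>0\<close> (index \<open>K\<close>) instead of \<open>m\<^sub>0\<close>;
    either way she is lost to \<open>m\<^sub>1\<close>.\<close>
  have "\<nu> (Suc j) (Suc j) = 1 \<and> \<nu> (Suc j) j \<noteq> 1" if "Suc j < K" for j
    using that
  proof (induction j)
    case 0
    obtain m w where mw: "m < 2 * K" "w < 2 * K" "\<nu> 0 w = 1" "\<nu> m 0 = 1"
      "\<forall>m'<2 * K. \<nu> m' 0 = 1 \<longrightarrow> m' = m" "U 0 w \<ge> 1 \<or> V m 0 \<ge> 1"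
      using cases[OF K] by blast
    have "m = 0 \<or> m = K"
    proof (rule disjE[OF mw(6)])
      assume "U 0 w \<ge> 1"
      then have "w = 0" using K by (auto simp: chain_U_def split: if_splits)
      then have "\<nu> 0 0 = 1" using mw(3) by simp
      then show ?thesis using mw(5)[rule_format, of 0] K by simp
    next
      assume "V m 0 \<ge> 1"
      then show ?thesis by (auto simp: chain_V_def split: if_splits)
    qed
    then have no: "\<nu> (Suc 0) 0 \<noteq> 1" using mw(5)[rule_format, of "Suc 0"] 0 by linarith
    obtain m w where mw: "m < 2 * K" "w < 2 * K" "\<nu> (Suc 0) w = 1" "\<nu> m (Suc 0) = 1"
      "U (Suc 0) w \<ge> 1 \<or> V m (Suc 0) \<ge> 1"
      using cases[OF 0] by blast
    \<comment> \<open>Without \<open>w\<^sub>0\<close>, the man \<open>m\<^sub>1\<close> values only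
      \<open>w\<^sub>1\<close>, and \<open>w\<^sub>1\<close> values only \<open>m\<^sub>1\<close>,
      so both alternatives give the same match.\<close>
    have "\<nu> (Suc 0) (Suc 0) = 1"
      using mw no 0 by (auto simp: chain_U_def chain_V_def split: if_splits)
    with no show ?case by simp
  next
    case (Suc j)
    have j: "Suc j < K" "Suc j < 2 * K" "Suc (Suc j) < 2 * K" using Suc.prems by simp_all
    obtain m where m: "\<forall>m'<2 * K. \<nu> m' (Suc j) = 1 \<longrightarrow> m' = m"
      using cases[OF j(1)] by blast
    have "Suc j = m" using Suc.IH[OF j(1)] m j(2) by blast
    then have no: "\<nu> (Suc (Suc j)) (Suc j) \<noteq> 1" using m j(3) by fastforce
    obtain m w where mw: "m < 2 * K" "w < 2 * K" "\<nu> (Suc (Suc j)) w = 1" "\<nu> m (Suc (Suc j)) = 1"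
      "U (Suc (Suc j)) w \<ge> 1 \<or> V m (Suc (Suc j)) \<ge> 1"
      using cases[OF Suc.prems] by blast
    have "\<nu> (Suc (Suc j)) (Suc (Suc j)) = 1"
      using mw no Suc.prems by (auto simp: chain_U_def chain_V_def split: if_splits)
    with no show ?case by simp
  qed
  then show ?thesis using i by (metis Suc_pred)
qed

text \<open>Each forced pair yields \<open>2\<close> and leaves its dummies without anyone they
  value. In the first unit \<open>m\<^sub>0\<close> gets at most \<open>1\<close>,
  \<open>w\<^sub>0\<close> and \<open>d\<^sub>0\<close> at most \<alpha> each, and
  \<open>e\<^sub>0\<close> nothing.\<close>

lemma chain_integral_welfare:
  assumes st: "stable_integral_matching (2 * K) U V \<nu>"
  shows "social_welfare (2 * K) U V \<nu> \<le> real (K - 1) * 2 + 2 * \<alpha> + 1"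
proof -
  obtain N where N: "K = Suc N" using K gr0_conv_Suc by auto
  have cm: "complete_matching (2 * K) \<nu>" "integral_matching (2 * K) \<nu>"
    using st by (auto simp: stable_integral_matching_def)
  note forced = chain_integral_forced[OF st]
  \<comment> \<open>The two implications close the forced pairs to outsiders from either side, which
    denies the later dummies their \<alpha>.\<close>
  have partner_m: "\<exists>w. w < 2 * K \<and> man_utility (2 * K) U \<nu> m = U m w \<and> \<nu> m w = 1 \<and>
      (0 < w \<and> w < K \<longrightarrow> m = w) \<and> (0 < m \<and> m < K \<longrightarrow> w = m)" if m: "m < 2 * K" for m
  proof -
    obtain w where w: "w < 2 * K" "\<And>w'. w' < 2 * K \<Longrightarrow> \<nu> m w' = (if w' = w then 1 else 0)"
      "\<And>U. man_utility (2 * K) U \<nu> m = U m w"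
      using integral_man_partner[OF cm m] by blast
    obtain m' where m': "\<And>m''. m'' < 2 * K \<Longrightarrow> \<nu> m'' w = (if m'' = m' then 1 else 0)"
      using integral_woman_partner[OF cm w(1)] by blast
    have "m = w" if "0 < w" "w < K"
      using m'[of m] m'[of w] forced[OF that] w(1) w(2)[OF w(1)] m
      by (metis zero_neq_one)
    moreover have "w = m" if "0 < m" "m < K"
      using w(2)[OF m] forced[OF that] by (metis zero_neq_one)
    moreover have "\<nu> m w = 1" using w(2)[OF w(1)] by simp
    ultimately show ?thesis using w(1) w(3)[of U] by blast
  qed
  have partner_w: "\<exists>m. m < 2 * K \<and> woman_utility (2 * K) V \<nu> w = V m w \<and> \<nu> m w = 1 \<and>
      (0 < w \<and> w < K \<longrightarrow> m = w) \<and> (0 < m \<and> m < K \<longrightarrow> w = m)" if w: "w < 2 * K" for w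
  proof -
    obtain m where m: "m < 2 * K" "\<And>m'. m' < 2 * K \<Longrightarrow> \<nu> m' w = (if m' = m then 1 else 0)"
      "\<And>V. woman_utility (2 * K) V \<nu> w = V m w"
      using integral_woman_partner[OF cm w] by blast
    obtain w' where w': "\<And>w''. w'' < 2 * K \<Longrightarrow> \<nu> m w'' = (if w'' = w' then 1 else 0)"
      using integral_man_partner[OF cm m(1)] by blast
    have "w = m" if "0 < m" "m < K"
      using w'[of m] w'[of w] forced[OF that] m(1) m(2)[OF m(1)] w
      by (metis zero_neq_one)
    moreover have "m = w" if "0 < w" "w < K"
      using m(2)[OF w] forced[OF that] by (metis zero_neq_one)
    moreover have "\<nu> m w = 1" using m(2)[OF m(1)] by simp
    ultimately show ?thesis using m(1) m(3)[of V] by blast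
  qed
  have "(\<Sum>m<2 * K. man_utility (2 * K) U \<nu> m) \<le> 1 + 0 + real N * (1 + 0)"
  proof (rule sum_two_blocks_le[OF N])
    show "man_utility (2 * K) U \<nu> 0 \<le> 1"
      using partner_m[of 0] K by (auto simp: chain_U_def)
    show "man_utility (2 * K) U \<nu> K \<le> 0"
      using partner_m[of K] K by (auto simp: chain_U_def)
    show "man_utility (2 * K) U \<nu> i \<le> 1" if "0 < i" "i < K" for i
      using partner_m[of i] that by (auto simp: chain_U_def)
    show "man_utility (2 * K) U \<nu> (K + i) \<le> 0" if "0 < i" "i < K" for i
      using partner_m[of "K + i"] that by (auto simp: chain_U_def)
  qed
  moreover have "(\<Sum>w<2 * K. woman_utility (2 * K) V \<nu> w) \<le> \<alpha> + \<alpha> + real N * (1 + 0)"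
  proof (rule sum_two_blocks_le[OF N])
    show "woman_utility (2 * K) V \<nu> 0 \<le> \<alpha>"
      using partner_w[of 0] K alpha by (auto simp: chain_V_def)
    show "woman_utility (2 * K) V \<nu> K \<le> \<alpha>"
      using partner_w[of K] K alpha by (auto simp: chain_V_def)
    show "woman_utility (2 * K) V \<nu> i \<le> 1" if "0 < i" "i < K" for i
      using partner_w[of i] that by (auto simp: chain_V_def)
    show "woman_utility (2 * K) V \<nu> (K + i) \<le> 0" if "0 < i" "i < K" for i
      using partner_w[of "K + i"] that by (auto simp: chain_V_def)
  qed
  ultimately show ?thesis
    unfolding social_welfare_def using N by simp
qed

end

section \<open>Choice of the chain length\<close>

theorem theorem1:
  fixes \<delta> \<alpha> :: real
  assumes "\<delta> > 0" and "\<alpha> \<ge> 2"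
  shows "\<exists>(n::nat) (U :: nat \<Rightarrow> nat \<Rightarrow> real) (V :: nat \<Rightarrow> nat \<Rightarrow> real) (\<mu> :: nat \<Rightarrow> nat \<Rightarrow> real).
    smc_instance n U V \<and>
    (\<alpha> \<in> \<rat> \<longrightarrow> rational_valuations n U V) \<and>
    ternary_valuations \<alpha> n U V \<and>
    optimal_stable_fractional_matching n U V \<mu> \<and>
    (\<delta> < \<alpha> - 1/2 \<longrightarrow> social_welfare n U V \<mu> > 0) \<and>
    (\<forall>\<mu>s. stable_integral_matching n U V \<mu>s \<longrightarrow>
       social_welfare n U V \<mu>s \<le> inverse (\<alpha> - 1/2 - \<delta>) * social_welfare n U V \<mu>)"
proof (cases "\<delta> < \<alpha> - 1/2")
  case True
  \<comment> \<open>\<open>N\<close> counts the units after the first. Cross-multiplying \<open>N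
    (2\<alpha> - 1) / (2N + 2\<alpha> + 1) \<ge> \<alpha> - 1/2 - \<delta>\<close> cancels
    \<open>N (2\<alpha> - 1)\<close>; it then suffices that \<open>2\<delta>N\<close> dominates
    \<open>(\<alpha> - 1/2)(2\<alpha> + 1)\<close>.\<close>
  obtain N :: nat where N: "(\<alpha> - 1/2) * (2 * \<alpha> + 1) / (2 * \<delta>) < real N"
    using reals_Archimedean2 by blast
  have "0 \<le> (\<alpha> - 1/2) * (2 * \<alpha> + 1) / (2 * \<delta>)" using assms by simp
  with N have "0 < N" by (metis less_le_trans not_le of_nat_0_less_iff)
  define K where "K = Suc N"
  have K: "0 < K" "K - 1 = N" by (simp_all add: K_def)
  let ?U = "chain_U K \<alpha>" and ?V = "chain_V K \<alpha>"
  obtain \<mu> where opt: "optimal_stable_fractional_matching (2 * K) ?U ?V \<mu>"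
    using optimal_stable_fractional_matching_exists chain_matching_stable[OF K(1) assms(2)] by blast
  \<comment> \<open>The optimum is only compared with the chain matching, not identified with
    it.\<close>
  then have W: "real N * (2 * \<alpha> - 1) \<le> social_welfare (2 * K) ?U ?V \<mu>"
    using chain_matching_stable[OF K(1) assms(2)] chain_matching_welfare[OF K(1) assms(2)] K(2)
    unfolding optimal_stable_fractional_matching_def by fastforce
  have "0 < real N * (2 * \<alpha> - 1)" using \<open>0 < N\<close> assms by simp
  with W have pos: "0 < social_welfare (2 * K) ?U ?V \<mu>" by linarith
  have bound: "(\<alpha> - 1/2 - \<delta>) * (real N * 2 + 2 * \<alpha> + 1) \<le> real N * (2 * \<alpha> - 1)"
  proof -
    have "(\<alpha> - 1/2) * (2 * \<alpha> + 1) \<le> 2 * \<delta> * real N"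
      using N assms by (simp add: divide_less_eq mult.commute)
    moreover have "0 \<le> \<delta> * (2 * \<alpha> + 1)" using assms by simp
    ultimately show ?thesis by (simp add: algebra_simps)
  qed
  have "social_welfare (2 * K) ?U ?V \<nu> \<le> inverse (\<alpha> - 1/2 - \<delta>) * social_welfare (2 * K) ?U ?V \<mu>"
    if "stable_integral_matching (2 * K) ?U ?V \<nu>" for \<nu>
  proof -
    have "(\<alpha> - 1/2 - \<delta>) * social_welfare (2 * K) ?U ?V \<nu> \<le> (\<alpha> - 1/2 - \<delta>) * (real N * 2 + 2 * \<alpha> + 1)"
      using chain_integral_welfare[OF K(1) assms(2) that] True K(2) by (intro mult_left_mono) simp_all
    with bound W have "(\<alpha> - 1/2 - \<delta>) * social_welfare (2 * K) ?U ?V \<nu> \<le> social_welfare (2 * K) ?U ?V \<mu>"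
      by linarith
    then show ?thesis using True by (simp add: field_simps)
  qed
  moreover have "smc_instance (2 * K) ?U ?V" "ternary_valuations \<alpha> (2 * K) ?U ?V"
    "\<alpha> \<in> \<rat> \<longrightarrow> rational_valuations (2 * K) ?U ?V"
    using K assms
    by (auto simp: smc_instance_def ternary_valuations_def rational_valuations_def chain_U_def chain_V_def)
  ultimately show ?thesis using opt pos by blast
next
  case False
  \<comment> \<open>The factor is then nonpositive (it is \<open>0\<close> for \<open>\<delta> = \<alpha> - 1/2\<close>), so the instance must have welfare \<open>0\<close>.\<close>
  let ?Z = "\<lambda>_ _ :: nat. 0 :: real"
  have "social_welfare 1 ?Z ?Z \<nu> = 0" for \<nu>
    by (simp add: social_welfare_def man_utility_def woman_utility_def)
  moreover have "stable_fractional_matching 1 ?Z ?Z (\<lambda>_ _. 1)"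
    by (simp add: stable_fractional_matching_def complete_matching_def fractional_matching_def
        stable_def man_utility_def)
  ultimately have "optimal_stable_fractional_matching 1 ?Z ?Z (\<lambda>_ _. 1)"
    "\<forall>\<nu>. social_welfare 1 ?Z ?Z \<nu> = 0"
    by (simp_all add: optimal_stable_fractional_matching_def)
  then show ?thesis
    using False
    by (intro exI[of _ 1] exI[of _ ?Z] exI[of _ "\<lambda>_ _. 1"])
      (simp add: smc_instance_def rational_valuations_def ternary_valuations_def)
qed

end
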